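(* Let $-\pi/2<\lambda<\pi/2$. The radius of starlikeness of the class $\mathcal{R}_\lambda$ of $\lambda$-Robertson functions is at least \[ R_{2}(\lambda)=\frac{2}{\sqrt{4+2\sqrt{3}\,|\sin(2\lambda)|}}; \] that is, for every $f\in\mathcal{R}_\lambda$, \[ \operatorname{Re}\frac{zf'(z)}{f(z)}>0\quad\text{for all } |z|<R_{2}(\lambda). \]
   Context: $\mathbb{D}=\{z\in\mathbb{C}:|z|<1\}$. For $-\pi/2<\lambda<\pi/2$, $\mathcal{R}_\lambda$ (the $\lambda$-Robertson functions) is the set of analytic functions $f$ on $\mathbb{D}$ with $f(0)=0$, $f'(0)=1$ such that $P_f(z)=1+\dfrac{zf''(z)}{f'(z)}$ is analytic in $\mathbb{D}$ and $\operatorname{Re}\big(e^{-i\lambda}P_f(z)\big)>0$ for all $z\in\mathbb{D}$. The radius of starlikeness of $\mathcal{R}_\lambda$ is the supremum of $r\in(0,1]$ such that for every $f\in\mathcal{R}_\lambda$ the function $zf'(z)/f(z)$ (with value $1$ at $z=0$) is analytic and has positive real part in $|z|<r$. *)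

theory Defs
  imports "HOL-Complex_Analysis.Complex_Analysis"
begin

text \<open>
  Division by zero yields \<open>0\<close> here. A zero of \<open>f'\<close> at some \<open>z \<noteq> 0\<close> in the disc is
  nevertheless a simple pole of \<open>z f''/f'\<close>, so holomorphy of \<open>P_fun f\<close> on the unit disc still
  excludes such zeros (unboundedness near \<open>z\<close>).
\<close>

definition P_fun :: "(complex \<Rightarrow> complex) \<Rightarrow> complex \<Rightarrow> complex" where
  "P_fun f z = 1 + z * deriv (deriv f) z / deriv f z"

definition Robertson :: "real \<Rightarrow> (complex \<Rightarrow> complex) set" where
  "Robertson lam = {f. f holomorphic_on ball 0 1 \<and> f 0 = 0 \<and> deriv f 0 = 1 \<and>
     P_fun f holomorphic_on ball 0 1 \<and>
     (\<forall>z\<in>ball 0 1. Re (exp (- \<i> * of_real lam) * P_fun f z) > 0)}"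

definition starlike_quotient :: "(complex \<Rightarrow> complex) \<Rightarrow> complex \<Rightarrow> complex" where
  "starlike_quotient f z = (if z = 0 then 1 else z * deriv f z / f z)"

text \<open>
  At a zero \<open>z \<noteq> 0\<close> of \<open>f\<close> the quotient takes the value \<open>0\<close>, which does not have positive
  real part, so the condition below fails as soon as \<open>f\<close> has a second zero in \<open>ball 0 r\<close>.
\<close>

definition starlike_up_to :: "real \<Rightarrow> (complex \<Rightarrow> complex) \<Rightarrow> bool" where
  "starlike_up_to r f \<longleftrightarrow> starlike_quotient f holomorphic_on ball 0 r \<and>
     (\<forall>z\<in>ball 0 r. Re (starlike_quotient f z) > 0)"

definition radius_of_starlikeness :: "(complex \<Rightarrow> complex) set \<Rightarrow> real" where
  "radius_of_starlikeness F = Sup {r. 0 < r \<and> r \<le> 1 \<and> (\<forall>f\<in>F. starlike_up_to r f)}"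

definition R\<^sub>2 :: "real \<Rightarrow> real" where
  "R\<^sub>2 lam = 2 / sqrt (4 + 2 * sqrt 3 * \<bar>sin (2 * lam)\<bar>)"

end

theory Submission
  imports Defs
begin

text \<open>
  Put \<open>p(z) = z f'(z) / f(z)\<close> and \<open>P(z) = 1 + z f''(z) / f'(z)\<close>. These are linked by
  \<open>P = p + z p' / p\<close>, and \<open>p(0) = 1\<close>. Suppose that \<open>Re p > 0\<close> fails somewhere, and let \<open>z\<^sub>0\<close> be a
  point of smallest modulus where it does. Two facts about \<open>P(z\<^sub>0)\<close> then force
  \<open>\<bar>z\<^sub>0\<bar> \<ge> R\<^sub>2(\<lambda>)\<close>.

  \<^item> \<^emph>\<open>The value \<open>P(z\<^sub>0)\<close> is imaginary and at least \<open>\<surd>3\<close> in modulus.\<close> The Cayley transform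
    \<open>w = (p - 1) / (p + 1)\<close> maps the disc \<open>\<bar>z\<bar> < \<bar>z\<^sub>0\<bar>\<close> into the unit disc, fixes \<open>0\<close> and has modulus
    \<open>1\<close> at \<open>z\<^sub>0\<close>, so Jack's lemma gives \<open>z\<^sub>0 w'(z\<^sub>0) = k w(z\<^sub>0)\<close> with a real \<open>k \<ge> 1\<close>. With
    \<open>p(z\<^sub>0) = i a\<close> this reads \<open>P(z\<^sub>0) = i (a + k (a\<^sup>2 + 1) / (2 a))\<close>, and
    \<open>\<bar>a\<bar> + (a\<^sup>2 + 1) / (2 \<bar>a\<bar>) = (3 \<bar>a\<bar> + 1 / \<bar>a\<bar>) / 2 \<ge> \<surd>3\<close>
    (\<open>Jack_lemma\<close>, \<open>imaginary_P_of_Jack_equation\<close>).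

  \<^item> \<^emph>\<open>The value \<open>P(z)\<close> is close to \<open>1\<close> when \<open>z\<close> is small.\<close> The condition
    \<open>Re (e\<^sup>-\<^sup>i\<^sup>\<lambda> P) > 0\<close> places \<open>P\<close> in a half-plane which \<open>\<zeta> \<mapsto> (\<zeta> - 1) / (\<zeta> + e\<^sup>2\<^sup>i\<^sup>\<lambda>)\<close>
    maps onto the unit disc, sending \<open>P(0) = 1\<close> to \<open>0\<close>. The Schwarz lemma yields
    \<open>\<bar>P(z) - 1\<bar> \<le> \<bar>z\<bar> \<bar>P(z) + e\<^sup>2\<^sup>i\<^sup>\<lambda>\<bar>\<close> (\<open>Robertson_Schwarz\<close>).

  For \<open>P(z\<^sub>0) = i y\<close> the second fact says \<open>1 \<le> \<bar>z\<^sub>0\<bar>\<^sup>2 (1 + 2 y sin 2\<lambda> / (1 + y\<^sup>2))\<close>. Since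
  \<open>2 y / (1 + y\<^sup>2)\<close> decreases for \<open>y \<ge> 1\<close>, the value \<open>\<bar>y\<bar> = \<surd>3\<close> is the extreme case, and it gives
  exactly \<open>\<bar>z\<^sub>0\<bar> \<ge> R\<^sub>2(\<lambda>)\<close> (\<open>R2_le_of_Schwarz_bound\<close>).

  The function \<open>p\<close> might have a pole at \<open>z\<^sub>0\<close>. The argument is therefore carried out with
  \<open>g(z) = f(z) / z\<close> in place of \<open>p\<close>: where \<open>g \<noteq> 0\<close>, the condition \<open>Re p > 0\<close> means
  \<open>\<bar>f' - g\<bar> < \<bar>f' + g\<bar>\<close>, and \<open>w = (f' - g) / (f' + g)\<close> has no pole at \<open>z\<^sub>0\<close> because \<open>f'\<close> has no
  zeros (\<open>Robertson_deriv_nonzero\<close>). A zero of \<open>g\<close> at \<open>z\<^sub>0\<close> would give \<open>k = -2\<close>, against \<open>k \<ge> 1\<close>.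
\<close>

section \<open>The lemmas of Schwarz and Jack\<close>

lemma Schwarz_scaled:
  assumes holf: "f holomorphic_on ball 0 r" and f0: "f 0 = 0"
    and less: "\<And>z. norm z < r \<Longrightarrow> norm (f z) < M"
    and z: "norm z < r"
  shows "r * norm (f z) \<le> M * norm z"
proof -
  have r: "r > 0" using z norm_ge_zero[of z] by linarith
  have M: "M > 0" using less[of 0] r f0 by simp
  define h where "h \<zeta> = f (of_real r * \<zeta>) / of_real M" for \<zeta>
  have img: "(\<lambda>\<zeta>::complex. of_real r * \<zeta>) ` ball 0 1 \<subseteq> ball 0 r"
    using r by (auto simp: norm_mult)
  have hol: "h holomorphic_on ball 0 1"
    unfolding h_def using M
    by (intro holomorphic_intros holomorphic_on_compose_gen[OF _ holf, unfolded o_def] img) auto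
  have lt: "norm (h \<zeta>) < 1" if "norm \<zeta> < 1" for \<zeta>
    using less[of "of_real r * \<zeta>"] that r M by (simp add: h_def norm_mult norm_divide)
  have "norm (h (z / of_real r)) \<le> norm (z / of_real r)"
    using z r f0 by (intro Schwarz_Lemma(1)[OF hol _ lt]) (auto simp: h_def norm_divide)
  then show ?thesis
    using r M by (simp add: h_def norm_divide field_simps)
qed

text \<open>
  At a first maximum point \<open>z\<^sub>0\<close> of \<open>\<bar>w\<bar>\<close> the derivative of \<open>\<bar>w\<bar>\<close> vanishes along the circle, which
  makes \<open>k = z\<^sub>0 w'(z\<^sub>0) / w(z\<^sub>0)\<close> real. Along the radius the Schwarz lemma bounds \<open>\<bar>w\<bar>\<close> by a linear
  function that it attains at \<open>z\<^sub>0\<close>, so \<open>\<bar>w\<bar>\<close> grows there at least as fast, that is \<open>k \<ge> 1\<close>.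
\<close>

lemma Jack_lemma:
  fixes w :: "complex \<Rightarrow> complex"
  assumes hol: "w holomorphic_on U" and U: "open U" "cball 0 (norm z0) \<subseteq> U"
    and w0: "w 0 = 0" and z0: "z0 \<noteq> 0"
    and less: "\<And>z. norm z < norm z0 \<Longrightarrow> norm (w z) < norm (w z0)"
  obtains k :: real where "k \<ge> 1" "z0 * deriv w z0 = of_real k * w z0"
proof -
  define M where "M = norm (w z0)"
  define A where "A = z0 * deriv w z0 * cnj (w z0)"
  have M: "M > 0" using less[of 0] z0 w0 by (simp add: M_def)
  have deriv_w: "(w has_field_derivative deriv w z0) (at z0)"
    using U by (intro holomorphic_derivI[OF hol]) auto
  \<comment> \<open>The real part of \<open>w(z) cnj (w(z\<^sub>0))\<close> is used in place of \<open>\<bar>w(z)\<bar>\<close>: it is linear in \<open>w\<close>,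
    bounded by \<open>M \<bar>w(z)\<bar>\<close>, and equal to \<open>M\<^sup>2\<close> at \<open>z\<^sub>0\<close>.\<close>
  have along: "((\<lambda>t. Re (w (c t) * cnj (w z0))) has_real_derivative Re (c' * deriv w z0 * cnj (w z0))) (at t)"
    if "(c has_vector_derivative c') (at t)" "c t = z0" for c c' t
  proof -
    have "((w \<circ> c) has_vector_derivative c' * deriv w z0) (at t)"
      using field_vector_diff_chain_at[OF that(1)] deriv_w that(2) by simp
    then have "((\<lambda>t. (w \<circ> c) t * cnj (w z0)) has_vector_derivative c' * deriv w z0 * cnj (w z0)) (at t)"
      by (rule has_vector_derivative_mult_left)
    then have "((\<lambda>t. Re ((w \<circ> c) t * cnj (w z0))) has_vector_derivative Re (c' * deriv w z0 * cnj (w z0))) (at t)"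
      by (rule bounded_linear.has_vector_derivative[OF bounded_linear_Re])
    then show ?thesis
      by (simp add: has_real_derivative_iff_has_vector_derivative o_def)
  qed
  have Re_le: "Re (w z * cnj (w z0)) \<le> norm (w z) * M" for z
    using complex_Re_le_cmod[of "w z * cnj (w z0)"] by (simp add: norm_mult M_def)
  have Re_z0: "Re (w z0 * cnj (w z0)) = M * M"
    unfolding M_def complex_mult_cnj cmod_def by (simp add: power2_eq_square)
  have Schwarz: "norm z0 * norm (w z) \<le> M * norm z" if "norm z < norm z0" for z
    unfolding M_def
    by (rule Schwarz_scaled[OF holomorphic_on_subset[OF hol] w0 less that]) (use U in auto)
  have sphere: "norm (w z) \<le> M" if "norm z = norm z0" for z
  proof (rule continuous_le_on_closure[where S = "ball 0 (norm z0)" and f = "\<lambda>z. norm (w z)"])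
    show "continuous_on (closure (ball 0 (norm z0))) (\<lambda>z. norm (w z))"
      using z0 U continuous_on_subset[OF holomorphic_on_imp_continuous_on[OF hol]]
      by (auto intro!: continuous_on_norm)
  qed (use that z0 less in \<open>auto simp: M_def less_imp_le\<close>)

  have ReA: "Re A \<ge> M * M"
  proof (rule ccontr)
    assume "\<not> ?thesis"
    then have neg: "Re A - M * M < 0" by simp
    have "((\<lambda>t. of_real t * z0) has_vector_derivative z0) (at (1::real))"
      by (auto intro!: derivative_eq_intros simp: has_vector_derivative_def scaleR_conv_of_real)
    then have "((\<lambda>t. Re (w (of_real t * z0) * cnj (w z0))) has_real_derivative Re A) (at 1)"
      unfolding A_def by (rule along) simp
    moreover have "((\<lambda>t. M * M * t) has_real_derivative M * M) (at 1)"
      by (auto intro!: derivative_eq_intros)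
    ultimately have "((\<lambda>t. Re (w (of_real t * z0) * cnj (w z0)) - M * M * t) has_real_derivative Re A - M * M) (at 1)"
      by (rule DERIV_diff)
    from DERIV_neg_dec_left[OF this neg] obtain d where d: "d > 0" and
      dec: "\<And>h. h > 0 \<Longrightarrow> h < d \<Longrightarrow> 0 < Re (w (of_real (1 - h) * z0) * cnj (w z0)) - M * M * (1 - h)"
      using Re_z0 by auto
    define h where "h = min (d / 2) (1 / 2)"
    have h: "h > 0" "h < d" "h < 1" using d by (auto simp: h_def)
    have nrm: "norm (of_real (1 - h) * z0) = (1 - h) * norm z0"
      unfolding norm_mult norm_of_real using h by simp
    have "norm (of_real (1 - h) * z0) < norm z0"
      unfolding nrm using h z0 by simp
    from Schwarz[OF this] have "norm (w (of_real (1 - h) * z0)) \<le> M * (1 - h)"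
      unfolding nrm using z0 by (simp add: mult_ac)
    then have "norm (w (of_real (1 - h) * z0)) * M \<le> M * (1 - h) * M"
      using M by (intro mult_right_mono) auto
    with Re_le[of "of_real (1 - h) * z0"] dec[OF h(1,2)] show False
      by (simp add: mult_ac)
  qed
  have ImA: "Im A = 0"
  proof -
    have "((\<lambda>t. z0 * exp (\<i> * of_real t)) has_vector_derivative z0 * \<i>) (at (0::real))"
    proof -
      have "((\<lambda>t. z0 * exp (\<i> * t)) has_field_derivative z0 * \<i>) (at (of_real 0))"
        by (auto intro!: derivative_eq_intros)
      from has_vector_derivative_real_field[OF this] show ?thesis by simp
    qed
    then have "((\<lambda>t. Re (w (z0 * exp (\<i> * of_real t)) * cnj (w z0)))
        has_real_derivative Re (z0 * \<i> * deriv w z0 * cnj (w z0))) (at 0)"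
      by (rule along) simp
    moreover have "z0 * \<i> * deriv w z0 * cnj (w z0) = \<i> * A" by (simp add: A_def)
    ultimately have der: "((\<lambda>t. Re (w (z0 * exp (\<i> * of_real t)) * cnj (w z0))) has_real_derivative - Im A) (at 0)"
      by simp
    have "- Im A = 0"
    proof (rule DERIV_local_max[OF der, of 1], simp, intro allI impI)
      fix t :: real
      have "norm (w (z0 * exp (\<i> * of_real t))) * M \<le> M * M"
        using M by (intro mult_right_mono sphere) (auto simp: norm_mult)
      with Re_le[of "z0 * exp (\<i> * of_real t)"]
      show "Re (w (z0 * exp (\<i> * of_real t)) * cnj (w z0)) \<le> Re (w (z0 * exp (\<i> * of_real 0)) * cnj (w z0))"
        using Re_z0 by simp
    qed
    then show ?thesis by simp
  qed
  show thesis
  proof (rule that)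
    show "Re A / (M * M) \<ge> 1" using ReA M by simp
    have "of_real (M * M) * (z0 * deriv w z0) = A * w z0"
      using complex_norm_square[of "w z0"] by (simp add: A_def M_def power2_eq_square mult_ac)
    also have "A = of_real (Re A)" using ImA by (simp add: complex_eq_iff)
    finally show "z0 * deriv w z0 = of_real (Re A / (M * M)) * w z0"
      using M by (simp add: field_simps)
  qed
qed

section \<open>The value of P at the first boundary point\<close>

text \<open>
  Here \<open>b\<close>, \<open>g\<close> and \<open>P\<close> stand for the values of \<open>f'(z)\<close>, \<open>f(z) / z\<close> and \<open>1 + z f''(z) / f'(z)\<close> at the
  point \<open>z\<^sub>0\<close>. The equation is \<open>z\<^sub>0 w'(z\<^sub>0) = k w(z\<^sub>0)\<close> for \<open>w = (f' - g) / (f' + g)\<close> with the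
  denominators cleared. In terms of \<open>p = b / g\<close>, which is imaginary because
  \<open>\<bar>b - g\<bar> = \<bar>b + g\<bar>\<close>, it becomes \<open>2 p (P - p) = k (p\<^sup>2 - 1)\<close> and can be solved for \<open>P\<close>.
\<close>

lemma imaginary_P_of_Jack_equation:
  fixes b g P :: complex and k :: real
  assumes k: "k \<ge> 1" and b: "b \<noteq> 0" and eq_norm: "norm (b - g) = norm (b + g)"
    and eq: "2 * b * (P * g - b) = of_real k * (b\<^sup>2 - g\<^sup>2)"
  obtains y where "P = \<i> * of_real y" "sqrt 3 \<le> \<bar>y\<bar>"
proof -
  have g: "g \<noteq> 0"
  proof
    assume "g = 0"
    with eq have "of_real (- 2) * b\<^sup>2 = of_real k * b\<^sup>2" by (simp add: power2_eq_square mult.assoc)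
    with b have "- 2 = k" by (simp only: mult_cancel_right of_real_eq_iff) simp
    with k show False by simp
  qed
  define a where "a = Im (b / g)"
  have "(norm (b - g))\<^sup>2 = (norm (b + g))\<^sup>2" using eq_norm by simp
  then have "Re b * Re g + Im b * Im g = 0"
    unfolding cmod_power2 by (simp add: power2_eq_square algebra_simps)
  then have "Re (b / g) = 0" by (simp add: Re_divide)
  then have "b / g = \<i> * of_real a" by (simp add: complex_eq_iff a_def)
  then have bg: "b = \<i> * of_real a * g" using g by (simp add: field_simps)
  have a: "a \<noteq> 0" using bg b by auto
  have "g\<^sup>2 * (2 * (\<i> * of_real a) * (P - \<i> * of_real a)) - g\<^sup>2 * (- of_real k * (of_real a ^ 2 + 1))
      = 2 * b * (P * g - b) - of_real k * (b\<^sup>2 - g\<^sup>2)"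
    unfolding bg by (simp add: power2_eq_square algebra_simps)
  then have "g\<^sup>2 * (2 * (\<i> * of_real a) * (P - \<i> * of_real a)) = g\<^sup>2 * (- of_real k * (of_real a ^ 2 + 1))"
    by (simp only: eq diff_self right_minus_eq)
  then have eqP: "2 * (\<i> * of_real a) * (P - \<i> * of_real a) = - of_real k * (of_real a ^ 2 + 1)"
    using g by (simp only: mult_cancel_left power_eq_0_iff simp_thms)
  define y where "y = a + k * (a\<^sup>2 + 1) / (2 * a)"
  have "\<i> * (2 * (\<i> * of_real a) * (P - \<i> * of_real a)) = \<i> * (- of_real k * (of_real a ^ 2 + 1))"
    using eqP by simp
  then have "P = \<i> * of_real y"
    using a unfolding y_def by (simp add: field_simps power2_eq_square)
  moreover have "sqrt 3 \<le> \<bar>y\<bar>"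
  proof -
    \<comment> \<open>The arithmetic-geometric mean inequality, with equality at \<open>\<bar>a\<bar> = 1 / \<surd>3\<close>.\<close>
    have "2 * \<bar>a\<bar> * sqrt 3 \<le> 3 * a\<^sup>2 + 1"
      using zero_le_power2[of "sqrt 3 * \<bar>a\<bar> - 1"]
      by (simp add: power2_diff power_mult_distrib mult_ac)
    also have "\<dots> \<le> 2 * a\<^sup>2 + k * (a\<^sup>2 + 1)"
      using mult_right_mono[OF k, of "a\<^sup>2 + 1"] by simp
    also have "\<dots> = \<bar>2 * a * y\<bar>"
    proof -
      have "2 * a * y = 2 * a\<^sup>2 + k * (a\<^sup>2 + 1)"
        using a by (simp add: y_def field_simps power2_eq_square)
      moreover have "k * (a\<^sup>2 + 1) \<ge> 0" using k by simp
      ultimately show ?thesis by simp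
    qed
    also have "\<dots> = 2 * \<bar>a\<bar> * \<bar>y\<bar>" by (simp add: abs_mult)
    finally show ?thesis using a by simp
  qed
  ultimately show thesis by (rule that)
qed

text \<open>
  Squaring the hypothesis gives \<open>1 + y\<^sup>2 \<le> r\<^sup>2 (1 + y\<^sup>2 + 2 y sin 2\<lambda>)\<close>. The ratio
  \<open>\<bar>y\<bar> / (1 + y\<^sup>2)\<close> decreases for \<open>\<bar>y\<bar> \<ge> 1\<close> and is \<open>\<surd>3 / 4\<close> at \<open>\<bar>y\<bar> = \<surd>3\<close>; this is where the
  constant \<open>2 \<surd>3\<close> in the radius comes from.
\<close>

lemma R2_le_of_Schwarz_bound:
  fixes y r lam :: real
  assumes y: "sqrt 3 \<le> \<bar>y\<bar>" and r: "r \<ge> 0"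
    and le: "norm (\<i> * of_real y - 1) \<le> r * norm (\<i> * of_real y + cis (2 * lam))"
  shows "R\<^sub>2 lam \<le> r"
proof -
  define s where "s = sin (2 * lam)"
  have "(norm (\<i> * of_real y - 1))\<^sup>2 \<le> (r * norm (\<i> * of_real y + cis (2 * lam)))\<^sup>2"
    using le by (intro power_mono) auto
  moreover have "(norm (\<i> * of_real y - 1))\<^sup>2 = 1 + y\<^sup>2"
    unfolding cmod_power2 by simp
  moreover have "(norm (\<i> * of_real y + cis (2 * lam)))\<^sup>2 = 1 + y\<^sup>2 + 2 * y * s"
    using sin_cos_squared_add[of "2 * lam"] unfolding cmod_power2 s_def
    by (simp add: power2_eq_square algebra_simps)
  ultimately have main: "1 + y\<^sup>2 \<le> r\<^sup>2 * (1 + y\<^sup>2 + 2 * y * s)"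
    by (simp add: power_mult_distrib)
  have s1: "sqrt 3 \<ge> (1::real)" by simp
  have "4 * \<bar>y\<bar> \<le> sqrt 3 * (1 + y\<^sup>2)"
  proof -
    have "1 * 1 \<le> sqrt 3 * \<bar>y\<bar>" using s1 y by (intro mult_mono order_trans[OF s1 y]) auto
    then have "0 \<le> (\<bar>y\<bar> - sqrt 3) * (sqrt 3 * \<bar>y\<bar> - 1)"
      using y by (intro mult_nonneg_nonneg) auto
    also have "\<dots> = sqrt 3 * (1 + y\<^sup>2) - (1 + sqrt 3 * sqrt 3) * \<bar>y\<bar>"
      by (simp add: algebra_simps power2_eq_square del: real_sqrt_mult_self)
    finally show ?thesis by simp
  qed
  then have "4 * \<bar>y\<bar> * \<bar>s\<bar> \<le> sqrt 3 * (1 + y\<^sup>2) * \<bar>s\<bar>" by (intro mult_right_mono) auto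
  moreover have "y * s \<le> \<bar>y\<bar> * \<bar>s\<bar>" by (metis abs_ge_self abs_mult)
  ultimately have "4 * (1 + y\<^sup>2 + 2 * y * s) \<le> (1 + y\<^sup>2) * (4 + 2 * sqrt 3 * \<bar>s\<bar>)"
    by (simp add: algebra_simps)
  then have "r\<^sup>2 * (4 * (1 + y\<^sup>2 + 2 * y * s)) \<le> r\<^sup>2 * ((1 + y\<^sup>2) * (4 + 2 * sqrt 3 * \<bar>s\<bar>))"
    by (intro mult_left_mono) auto
  with main have "(1 + y\<^sup>2) * 4 \<le> (1 + y\<^sup>2) * (r\<^sup>2 * (4 + 2 * sqrt 3 * \<bar>s\<bar>))"
    by (simp add: algebra_simps)
  then have "4 \<le> r\<^sup>2 * (4 + 2 * sqrt 3 * \<bar>s\<bar>)"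
    by (rule mult_left_le_imp_le) (simp add: add_pos_nonneg)
  then have "sqrt 4 \<le> sqrt (r\<^sup>2 * (4 + 2 * sqrt 3 * \<bar>s\<bar>))" by (rule real_sqrt_le_mono)
  then have "2 \<le> r * sqrt (4 + 2 * sqrt 3 * \<bar>s\<bar>)" using r by (simp add: real_sqrt_mult)
  moreover have "sqrt (4 + 2 * sqrt 3 * \<bar>s\<bar>) > 0" by (simp add: add_pos_nonneg)
  ultimately show ?thesis by (simp add: R\<^sub>2_def s_def divide_le_eq)
qed

lemma R2_pos: "0 < R\<^sub>2 lam" and R2_le_1: "R\<^sub>2 lam \<le> 1"
proof -
  define d where "d = sqrt (4 + 2 * sqrt 3 * \<bar>sin (2 * lam)\<bar>)"
  have "2 \<le> d" unfolding d_def by (rule real_le_rsqrt) simp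
  then show "0 < R\<^sub>2 lam" "R\<^sub>2 lam \<le> 1" unfolding R\<^sub>2_def d_def[symmetric] by simp_all
qed

section \<open>Robertson functions\<close>

lemma RobertsonD:
  assumes "f \<in> Robertson lam"
  shows "f holomorphic_on ball 0 1" "f 0 = 0" "deriv f 0 = 1" "P_fun f holomorphic_on ball 0 1"
    "\<And>z. norm z < 1 \<Longrightarrow> Re (exp (- \<i> * of_real lam) * P_fun f z) > 0"
  using assms by (auto simp: Robertson_def)

text \<open>
  Since \<open>P - 1\<close> is holomorphic and vanishes at \<open>0\<close>, it equals \<open>z q(z)\<close> with \<open>q\<close> holomorphic, and
  \<open>f'\<close> solves the linear equation \<open>f'' = q f'\<close>. Its solution with \<open>f'(0) = 1\<close> is the exponential of
  a primitive of \<open>q\<close>, which has no zeros.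
\<close>

lemma Robertson_deriv_nonzero:
  assumes f: "f \<in> Robertson lam" and z: "norm z < 1"
  shows "deriv f z \<noteq> 0"
proof -
  note R = RobertsonD[OF f]
  have hol1: "deriv f holomorphic_on ball 0 1" using R(1) by (rule holomorphic_deriv) simp
  have hol2: "deriv (deriv f) holomorphic_on ball 0 1" using hol1 by (rule holomorphic_deriv) simp
  have "(\<lambda>z. P_fun f z - 1) holomorphic_on ball 0 1" using R(4) by (intro holomorphic_intros)
  then obtain q where hol_q: "q holomorphic_on ball 0 1"
    and q: "\<And>z. norm z < 1 \<Longrightarrow> P_fun f z - 1 = z * q z"
    by (rule Schwarz3) (auto simp: P_fun_def)
  have "continuous_on (ball 0 1) (deriv f)" using hol1 by (rule holomorphic_on_imp_continuous_on)
  then have "\<forall>\<^sub>F z in at 0. deriv f z \<noteq> 0"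
    using R(3) by (intro tendsto_imp_eventually_ne[of _ 1])
      (auto simp: continuous_on_eq_continuous_at continuous_at dest!: bspec[of _ _ 0])
  then obtain e where e: "e > 0" "\<And>z. z \<noteq> 0 \<Longrightarrow> dist z 0 < e \<Longrightarrow> deriv f z \<noteq> 0"
    unfolding eventually_at by blast
  define S :: "complex set" where "S = ball 0 (min e 1) - {0}"
  \<comment> \<open>The definition of \<open>P_fun\<close> yields the equation only where \<open>f'\<close> is known to be nonzero and \<open>z\<close> can
    be cancelled; the identity theorem carries it to the whole disc.\<close>
  have ode: "deriv (deriv f) z = q z * deriv f z" if "norm z < 1" for z
  proof (rule analytic_continuation_open[where s = S and s' = "ball 0 1"
        and f = "deriv (deriv f)" and g = "\<lambda>z. q z * deriv f z"])
    show "S \<noteq> {}"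
    proof -
      have "of_real (min e 1 / 2) \<in> S" using e(1) by (auto simp: S_def min_def)
      then show ?thesis by blast
    qed
    show "deriv (deriv f) z = q z * deriv f z" if "z \<in> S" for z
    proof -
      have "z \<noteq> 0" "norm z < 1" "deriv f z \<noteq> 0" using that e(2)[of z] by (auto simp: S_def)
      with q[of z] show ?thesis by (simp add: P_fun_def field_simps)
    qed
  qed (use that in \<open>auto simp: S_def intro!: holomorphic_intros hol1 hol2 hol_q\<close>)
  obtain E where E: "\<And>x. x \<in> ball 0 1 \<Longrightarrow> (E has_field_derivative q x) (at x within ball 0 1)"
    using holomorphic_convex_primitive'[OF _ _ hol_q] by (metis convex_ball open_ball)
  have "\<exists>c. \<forall>x\<in>ball 0 1. deriv f x * exp (- E x) = c"
  proof (rule has_field_derivative_zero_constant)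
    fix x :: complex assume x: "x \<in> ball 0 1"
    have "(deriv f has_field_derivative deriv (deriv f) x) (at x within ball 0 1)"
      using holomorphic_derivI[OF hol1 _ x] by simp
    then show "((\<lambda>x. deriv f x * exp (- E x)) has_field_derivative 0) (at x within ball 0 1)"
      using ode[of x] x by (auto intro!: derivative_eq_intros E[OF x])
  qed simp
  then obtain c where c: "\<And>x. norm x < 1 \<Longrightarrow> deriv f x * exp (- E x) = c" by auto
  have "c \<noteq> 0" using c[of 0] R(3) by auto
  with c[OF z] show ?thesis by auto
qed

text \<open>
  The point \<open>-e\<^sup>2\<^sup>i\<^sup>\<lambda>\<close> is the mirror image of \<open>1\<close> in the line \<open>Re (e\<^sup>-\<^sup>i\<^sup>\<lambda> \<zeta>) = 0\<close>, so the
  half-plane containing the values of \<open>P\<close> consists of the points closer to \<open>1\<close> than to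
  \<open>-e\<^sup>2\<^sup>i\<^sup>\<lambda>\<close>. Hence \<open>(P - 1) / (P + e\<^sup>2\<^sup>i\<^sup>\<lambda>)\<close> satisfies the hypotheses of the Schwarz lemma.
\<close>

lemma Robertson_Schwarz:
  assumes lam: "- pi / 2 < lam" "lam < pi / 2" and f: "f \<in> Robertson lam" and z: "norm z < 1"
  shows "norm (P_fun f z - 1) \<le> norm z * norm (P_fun f z + cis (2 * lam))"
proof -
  note R = RobertsonD[OF f]
  have cos: "cos lam > 0" using lam by (intro cos_gt_zero_pi) auto
  have lt: "norm (P_fun f z - 1) < norm (P_fun f z + cis (2 * lam))" if "norm z < 1" for z
  proof -
    define P where "P = P_fun f z"
    have "exp (- \<i> * of_real lam) = cis (- lam)" by (simp add: cis_conv_exp)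
    then have "0 < cos lam * Re P + sin lam * Im P"
      using R(5)[OF that] by (simp add: P_def)
    then have "0 < 4 * cos lam * (cos lam * Re P + sin lam * Im P)" using cos by simp
    also have "\<dots> = (norm (P + cis (2 * lam)))\<^sup>2 - (norm (P - 1))\<^sup>2"
    proof -
      have "(norm (P + cis (2 * lam)))\<^sup>2 - (norm (P - 1))\<^sup>2
        = ((sin (2 * lam))\<^sup>2 + (cos (2 * lam))\<^sup>2 - 1) + 2 * Re P * (cos (2 * lam) + 1) + 2 * Im P * sin (2 * lam)"
        unfolding cmod_power2 by (simp add: power2_eq_square algebra_simps)
      also have "\<dots> = 2 * Re P * (2 * (cos lam)\<^sup>2) + 2 * Im P * (2 * sin lam * cos lam)"
        by (simp only: sin_cos_squared_add) (simp add: cos_double_cos sin_double)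
      finally show ?thesis by (simp add: power2_eq_square algebra_simps)
    qed
    finally have "(norm (P - 1))\<^sup>2 < (norm (P + cis (2 * lam)))\<^sup>2" by simp
    then show ?thesis unfolding P_def by (rule power_less_imp_less_base) simp
  qed
  define \<phi> where "\<phi> z = (P_fun f z - 1) / (P_fun f z + cis (2 * lam))" for z
  have ne: "P_fun f z + cis (2 * lam) \<noteq> 0" if "norm z < 1" for z using lt[OF that] by auto
  have "norm (\<phi> z) \<le> norm z"
  proof (rule Schwarz_Lemma(1)[OF _ _ _ z])
    show "\<phi> holomorphic_on ball 0 1"
      unfolding \<phi>_def using ne by (intro holomorphic_intros R(4)) auto
    show "\<phi> 0 = 0" by (simp add: \<phi>_def P_fun_def)
    show "norm (\<phi> z) < 1" if "norm z < 1" for z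
      using lt[OF that] ne[OF that] by (simp add: \<phi>_def norm_divide)
  qed
  then show ?thesis using ne[OF z] by (simp add: \<phi>_def norm_divide field_simps)
qed

section \<open>Starlikeness\<close>

lemma norm_diff_less_norm_add_iff_Re_divide:
  fixes b g :: complex
  assumes "g \<noteq> 0"
  shows "norm (b - g) < norm (b + g) \<longleftrightarrow> 0 < Re (b / g)"
proof -
  have "norm (b - g) < norm (b + g) \<longleftrightarrow> (norm (b - g))\<^sup>2 < (norm (b + g))\<^sup>2"
    by (auto intro: power_strict_mono dest: power_less_imp_less_base)
  also have "\<dots> \<longleftrightarrow> 0 < Re b * Re g + Im b * Im g"
  proof -
    define d where "d = Re b * Re g + Im b * Im g"
    have "(norm (b + g))\<^sup>2 = (norm (b - g))\<^sup>2 + 4 * d"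
      unfolding cmod_power2 d_def by (simp add: power2_eq_square algebra_simps)
    then show ?thesis unfolding d_def[symmetric] by simp
  qed
  also have "\<dots> \<longleftrightarrow> 0 < Re (b / g)"
  proof -
    have "(Re g)\<^sup>2 + (Im g)\<^sup>2 > 0"
      using assms by (simp add: sum_power2_gt_zero_iff complex_eq_iff)
    then show ?thesis by (simp add: Re_divide zero_less_divide_iff)
  qed
  finally show ?thesis .
qed

text \<open>
  This is \<open>Re (z f'(z) / f(z)) > 0\<close> in a form that makes sense at zeros of \<open>f\<close>. If it fails in
  the disc of radius \<open>R\<^sub>2(\<lambda>)\<close>, compactness supplies a failure \<open>z\<^sub>0\<close> of least modulus, where equality
  must hold. Jack's lemma at \<open>z\<^sub>0\<close> and the Schwarz bound for \<open>P(z\<^sub>0)\<close> then contradict each other.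
\<close>

lemma Robertson_quotient_in_half_plane:
  assumes lam: "- pi / 2 < lam" "lam < pi / 2" and f: "f \<in> Robertson lam"
    and hol_g: "g holomorphic_on ball 0 1" and fg: "\<And>z. norm z < 1 \<Longrightarrow> f z = z * g z" and g0: "g 0 = 1"
    and z: "norm z < R\<^sub>2 lam"
  shows "norm (deriv f z - g z) < norm (deriv f z + g z)"
proof (rule ccontr)
  assume not_less: "\<not> ?thesis"
  note R = RobertsonD[OF f]
  have hol1: "deriv f holomorphic_on ball 0 1" using R(1) by (rule holomorphic_deriv) simp
  define N where "N z = deriv f z - g z" for z
  define D where "D z = deriv f z + g z" for z
  have hol_N: "N holomorphic_on ball 0 1" and hol_D: "D holomorphic_on ball 0 1"
    unfolding N_def D_def by (intro holomorphic_intros hol1 hol_g)+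
  note cont = holomorphic_on_imp_continuous_on[OF hol_N] holomorphic_on_imp_continuous_on[OF hol_D]
  have z1: "norm z < 1" using z R2_le_1[of lam] by simp
  define S where "S = {x \<in> cball 0 (norm z). norm (D x) \<le> norm (N x)}"
  have sub: "cball 0 (norm z) \<subseteq> (ball 0 1 :: complex set)" using z1 by auto
  have "compact S"
  proof -
    have "closed S"
      unfolding S_def
      by (intro continuous_on_closed_Collect_le continuous_on_norm continuous_on_subset[OF cont(1) sub]
          continuous_on_subset[OF cont(2) sub] closed_cball)
    moreover have "bounded S" by (rule bounded_subset[OF bounded_cball[of 0 "norm z"]]) (auto simp: S_def)
    ultimately show ?thesis by (simp add: compact_eq_bounded_closed)
  qed
  moreover have "z \<in> S" using not_less by (simp add: S_def N_def D_def)
  ultimately obtain z0 where z0: "z0 \<in> S" and least: "\<And>x. x \<in> S \<Longrightarrow> norm z0 \<le> norm x"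
    using continuous_attains_inf[of S norm] by (auto intro: continuous_intros)
  have z0_le: "norm z0 \<le> norm z" using z0 by (simp add: S_def)
  have z0_1: "norm z0 < 1" using z0_le z1 by simp
  have z0_ge: "norm (D z0) \<le> norm (N z0)" using z0 by (simp add: S_def)
  have inside: "norm (N x) < norm (D x)" if "norm x < norm z0" for x
    using least[of x] that z0_le by (force simp: S_def)
  have ND0: "N 0 = 0" "D 0 = 2" by (simp_all add: N_def D_def R g0)
  then have z0_ne: "z0 \<noteq> 0" using z0_ge by auto
  have closed_le: "norm (N x) \<le> norm (D x)" if "norm x \<le> norm z0" for x
  proof -
    have "norm (N x) - norm (D x) \<le> 0"
    proof (rule continuous_le_on_closure[where S = "ball 0 (norm z0)"
          and f = "\<lambda>x. norm (N x) - norm (D x)"])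
      show "continuous_on (closure (ball 0 (norm z0))) (\<lambda>x. norm (N x) - norm (D x))"
        using z0_ne z0_1 by (auto intro!: continuous_intros intro: continuous_on_subset[OF cont(1)] continuous_on_subset[OF cont(2)])
    qed (use that z0_ne inside in \<open>auto simp: less_imp_le\<close>)
    then show ?thesis by simp
  qed
  have D_ne: "D x \<noteq> 0" if "norm x \<le> norm z0" for x
  proof
    assume "D x = 0"
    with closed_le[OF that] have "N x + D x = 0" by simp
    then have "deriv f x = 0" by (simp add: N_def D_def)
    with Robertson_deriv_nonzero[OF f] that z0_1 show False by simp
  qed
  have eq_norm: "norm (N z0) = norm (D z0)" using closed_le[of z0] z0_ge by simp
  \<comment> \<open>Jack's lemma takes the derivative at \<open>z\<^sub>0\<close>, so \<open>w\<close> is considered on a domain reaching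
    beyond the disc of radius \<open>\<bar>z\<^sub>0\<bar>\<close>.\<close>
  define U where "U = ball 0 1 \<inter> D -` (- {0})"
  have U: "open U"
    unfolding U_def by (rule continuous_open_preimage[OF cont(2)]) auto
  have cball_U: "cball 0 (norm z0) \<subseteq> U" using z0_1 D_ne by (auto simp: U_def)
  define w where "w x = N x / D x" for x
  have hol_w: "w holomorphic_on U"
    unfolding w_def U_def
    by (intro holomorphic_intros holomorphic_on_subset[OF hol_N] holomorphic_on_subset[OF hol_D]) auto
  have norm_w: "norm (w z0) = 1" using eq_norm D_ne[of z0] by (simp add: w_def norm_divide)
  obtain k where k: "k \<ge> 1" and Jack_k: "z0 * deriv w z0 = of_real k * w z0"
  proof (rule Jack_lemma[OF hol_w U cball_U _ z0_ne])
    show "w 0 = 0" by (simp add: w_def ND0)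
    show "norm (w x) < norm (w z0)" if "norm x < norm z0" for x
      using inside[OF that] D_ne[of x] that unfolding norm_w by (simp add: w_def norm_divide)
  qed
  define b where "b = deriv f z0"
  define c where "c = g z0"
  define P where "P = P_fun f z0"
  have b_ne: "b \<noteq> 0" using Robertson_deriv_nonzero[OF f z0_1] by (simp add: b_def)
  have d2: "z0 * deriv (deriv f) z0 = (P - 1) * b"
    using b_ne by (simp add: P_def b_def P_fun_def)
  have derf: "(deriv f has_field_derivative deriv (deriv f) z0) (at z0)"
    using z0_1 by (intro holomorphic_derivI[OF hol1]) auto
  have derg: "(g has_field_derivative deriv g z0) (at z0)"
    using z0_1 by (intro holomorphic_derivI[OF hol_g]) auto
  have dg: "z0 * deriv g z0 = b - c"
  proof -
    have "((\<lambda>z. z * g z) has_field_derivative c + z0 * deriv g z0) (at z0)"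
      using derg by (auto intro!: derivative_eq_intros simp: c_def)
    then have "(f has_field_derivative c + z0 * deriv g z0) (at z0)"
      by (rule has_field_derivative_transform_within_open[of _ _ _ "ball 0 1"])
        (use z0_1 fg in auto)
    then have "deriv f z0 = c + z0 * deriv g z0" by (rule DERIV_imp_deriv)
    then show ?thesis by (simp add: b_def)
  qed
  have Dz0: "D z0 = b + c" "N z0 = b - c" by (simp_all add: D_def N_def b_def c_def)
  have "(w has_field_derivative ((deriv (deriv f) z0 - deriv g z0) * D z0 - N z0 * (deriv (deriv f) z0 + deriv g z0)) / (D z0 * D z0)) (at z0)"
    unfolding w_def using D_ne[of z0] derf derg
    by (auto intro!: derivative_eq_intros simp: N_def D_def)
  then have "deriv w z0 = ((deriv (deriv f) z0 - deriv g z0) * D z0 - N z0 * (deriv (deriv f) z0 + deriv g z0)) / (D z0 * D z0)"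
    by (rule DERIV_imp_deriv)
  then have "deriv w z0 * (D z0 * D z0) = (deriv (deriv f) z0 - deriv g z0) * D z0 - N z0 * (deriv (deriv f) z0 + deriv g z0)"
    using D_ne[of z0] by simp
  then have "z0 * (deriv w z0 * (D z0 * D z0)) = z0 * ((deriv (deriv f) z0 - deriv g z0) * D z0 - N z0 * (deriv (deriv f) z0 + deriv g z0))"
    by simp
  then have "z0 * deriv w z0 * (D z0 * D z0) = (z0 * deriv (deriv f) z0 - z0 * deriv g z0) * D z0 - N z0 * (z0 * deriv (deriv f) z0 + z0 * deriv g z0)"
    by (simp only: ring_distribs mult_ac)
  also have "\<dots> = 2 * b * (P * c - b)"
    unfolding d2 dg Dz0 by (simp add: algebra_simps)
  finally have "2 * b * (P * c - b) = of_real k * w z0 * (D z0 * D z0)"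
    unfolding Jack_k ..
  also have "\<dots> = of_real k * ((w z0 * D z0) * D z0)" by (simp only: mult_ac)
  also have "w z0 * D z0 = N z0" using D_ne[of z0] by (simp add: w_def)
  also have "N z0 * D z0 = b\<^sup>2 - c\<^sup>2" by (simp add: Dz0 power2_eq_square algebra_simps)
  finally have key: "2 * b * (P * c - b) = of_real k * (b\<^sup>2 - c\<^sup>2)" .
  obtain y where y: "P = \<i> * of_real y" "sqrt 3 \<le> \<bar>y\<bar>"
    using imaginary_P_of_Jack_equation[OF k b_ne _ key] eq_norm unfolding Dz0 by blast
  have "R\<^sub>2 lam \<le> norm z0"
    using R2_le_of_Schwarz_bound[OF y(2) norm_ge_zero] Robertson_Schwarz[OF lam f z0_1] y(1) by (simp add: P_def)
  with z0_le z show False by simp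
qed

lemma Robertson_starlike_up_to_R2:
  assumes lam: "- pi / 2 < lam" "lam < pi / 2" and f: "f \<in> Robertson lam"
  shows "starlike_up_to (R\<^sub>2 lam) f"
proof -
  note R = RobertsonD[OF f]
  obtain g where hol_g: "g holomorphic_on ball 0 1" and fg: "\<And>z. norm z < 1 \<Longrightarrow> f z = z * g z"
    and g0: "deriv f 0 = g 0"
    by (rule Schwarz3[OF R(1,2)]) auto
  have g0: "g 0 = 1" using g0 R(3) by simp
  have lt: "norm (deriv f z - g z) < norm (deriv f z + g z)" if "norm z < R\<^sub>2 lam" for z
    using Robertson_quotient_in_half_plane[OF lam f hol_g fg g0 that] .
  have g_ne: "g z \<noteq> 0" if "norm z < R\<^sub>2 lam" for z using lt[OF that] by auto
  have eq: "starlike_quotient f z = deriv f z / g z" if "norm z < R\<^sub>2 lam" for z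
    using that fg[of z] R2_le_1[of lam] g0 R(3) by (auto simp: starlike_quotient_def)
  have sub: "ball 0 (R\<^sub>2 lam) \<subseteq> ball (0::complex) 1" using R2_le_1 by (rule subset_ball)
  have hol1: "deriv f holomorphic_on ball 0 1" using R(1) by (rule holomorphic_deriv) simp
  have "(\<lambda>z. deriv f z / g z) holomorphic_on ball 0 (R\<^sub>2 lam)"
    using g_ne sub
    by (intro holomorphic_intros holomorphic_on_subset[OF hol1] holomorphic_on_subset[OF hol_g]) auto
  then have "starlike_quotient f holomorphic_on ball 0 (R\<^sub>2 lam)"
    by (rule holomorphic_transform) (simp add: eq)
  then show ?thesis
    using lt norm_diff_less_norm_add_iff_Re_divide[OF g_ne] by (auto simp: starlike_up_to_def eq)
qed

theorem corollary2:
  fixes lam :: real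
  assumes "- pi / 2 < lam" and "lam < pi / 2"
  shows "R\<^sub>2 lam \<le> radius_of_starlikeness (Robertson lam) \<and>
    (\<forall>f\<in>Robertson lam. \<forall>z. norm z < R\<^sub>2 lam \<longrightarrow> Re (starlike_quotient f z) > 0)"
proof
  note starlike = Robertson_starlike_up_to_R2[OF assms]
  show "R\<^sub>2 lam \<le> radius_of_starlikeness (Robertson lam)"
    unfolding radius_of_starlikeness_def
    using starlike R2_pos R2_le_1 by (intro cSup_upper bdd_aboveI[of _ 1]) auto
  show "\<forall>f\<in>Robertson lam. \<forall>z. norm z < R\<^sub>2 lam \<longrightarrow> Re (starlike_quotient f z) > 0"
    using starlike by (auto simp: starlike_up_to_def)
qed

end
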